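(* Let $\alpha_1, A_1, \alpha_2 > 0$ and consider the system of difference equations $$x_{n+1}=\frac{\alpha_{1}}{A_{1}+y_{n}},\qquad y_{n+1}=\frac{\alpha_{2}}{y_{n}},\qquad n=0,1,2,\dots,$$ with arbitrary nonnegative initial conditions $x_0,y_0$ such that the denominators are never zero. This system has a unique equilibrium $$(\bar{x},\bar{y})=\left(\frac{\alpha_{1}}{A_{1}+\sqrt{\alpha_{2}}},\sqrt{\alpha_{2}}\right).$$ Moreover, every solution satisfies $(x_{n},y_{n})=(x_{n+2},y_{n+2})$ for all $n\geq 1$. Therefore every solution is eventually periodic with not necessarily prime period $2$.
   Context: The state space consists of nonnegative points. An equilibrium is a point $(\bar x,\bar y)\in[0,\infty)^2$ at which no denominator vanishes and such that the constant sequence $(x_n,y_n)=(\bar x,\bar y)$ solves the system. The initial conditions for which no denominator ever vanishes are those with $x_0\ge 0$, $y_0>0$. "Eventually periodic with not necessarily prime period 2" means that $(x_{n+2},y_{n+2})=(x_n,y_n)$ for all sufficiently large $n$ (2 need not be the minimal period). *)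

theory Defs
  imports Complex_Main
begin

text \<open>The nonvanishing of the denominators is required explicitly, since division by zero
  is total in HOL. Nonnegativity is required of the initial point only.\<close>

definition is_solution ::
  "real \<Rightarrow> real \<Rightarrow> real \<Rightarrow> (nat \<Rightarrow> real) \<Rightarrow> (nat \<Rightarrow> real) \<Rightarrow> bool" where
  "is_solution \<alpha>1 A1 \<alpha>2 x y \<longleftrightarrow>
     x 0 \<ge> 0 \<and> y 0 \<ge> 0 \<and>
     (\<forall>n. A1 + y n \<noteq> 0 \<and> y n \<noteq> 0 \<and>
          x (Suc n) = \<alpha>1 / (A1 + y n) \<and> y (Suc n) = \<alpha>2 / y n)"

definition is_equilibrium :: "real \<Rightarrow> real \<Rightarrow> real \<Rightarrow> real \<times> real \<Rightarrow> bool" where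
  "is_equilibrium \<alpha>1 A1 \<alpha>2 p \<longleftrightarrow>
     fst p \<ge> 0 \<and> snd p \<ge> 0 \<and> is_solution \<alpha>1 A1 \<alpha>2 (\<lambda>n. fst p) (\<lambda>n. snd p)"

text \<open>The period \<open>p\<close> need not be the minimal one.\<close>

definition eventually_periodic :: "nat \<Rightarrow> (nat \<Rightarrow> 'a) \<Rightarrow> bool" where
  "eventually_periodic p z \<longleftrightarrow> p > 0 \<and> (\<exists>N. \<forall>n\<ge>N. z (n + p) = z n)"

text \<open>The admissible initial conditions are exactly those with \<open>x0 \<ge> 0\<close> and \<open>y0 > 0\<close>;
  in particular, solutions exist.\<close>

lemma ex_solution_iff:
  assumes "\<alpha>1 > 0" "A1 > 0" "\<alpha>2 > 0"
  shows "(\<exists>x y. is_solution \<alpha>1 A1 \<alpha>2 x y \<and> x 0 = x0 \<and> y 0 = y0) \<longleftrightarrow> x0 \<ge> 0 \<and> y0 > 0"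
proof
  assume "\<exists>x y. is_solution \<alpha>1 A1 \<alpha>2 x y \<and> x 0 = x0 \<and> y 0 = y0"
  then show "x0 \<ge> 0 \<and> y0 > 0"
    unfolding is_solution_def by (metis order_le_less)
next
  assume init: "x0 \<ge> 0 \<and> y0 > 0"
  define y where "y = rec_nat y0 (\<lambda>_ v. \<alpha>2 / v)"
  define x where "x = case_nat x0 (\<lambda>n. \<alpha>1 / (A1 + y n))"
  have y0: "y 0 = y0" and ySuc: "y (Suc n) = \<alpha>2 / y n" for n
    by (simp_all add: y_def)
  have pos: "y n > 0" for n
    by (induction n) (use init assms y0 ySuc in auto)
  have ne: "y n \<noteq> 0" "A1 + y n \<noteq> 0" for n
    using pos[of n] assms by auto
  have "is_solution \<alpha>1 A1 \<alpha>2 x y"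
    unfolding is_solution_def using init y0 ySuc ne by (auto simp: x_def)
  moreover have "x 0 = x0" by (simp add: x_def)
  ultimately show "\<exists>x y. is_solution \<alpha>1 A1 \<alpha>2 x y \<and> x 0 = x0 \<and> y 0 = y0"
    using y0 by blast
qed

end

theory Submission
  imports Defs
begin

text \<open>The second equation is autonomous, and v \<mapsto> \<alpha>2 / v is an involution on the
  nonzero reals, so y has period 2 from the start (\<open>solution_y_add_2\<close>). Each x_{n+1} is
  a function of y_n alone, so x inherits the period one step later
  (\<open>solution_x_add_2\<close>). An equilibrium is a nonnegative fixed point of the involution,
  with the first coordinate then forced (\<open>is_equilibrium_iff\<close>).\<close>

lemma is_equilibrium_iff:
  assumes "\<alpha>1 > 0" "A1 > 0" "\<alpha>2 > 0"
  shows "is_equilibrium \<alpha>1 A1 \<alpha>2 p \<longleftrightarrow> p = (\<alpha>1 / (A1 + sqrt \<alpha>2), sqrt \<alpha>2)"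
proof
  assume eq: "is_equilibrium \<alpha>1 A1 \<alpha>2 p"
  then have nonneg: "snd p \<ge> 0" and ne: "snd p \<noteq> 0"
    and fst: "fst p = \<alpha>1 / (A1 + snd p)" and snd: "snd p = \<alpha>2 / snd p"
    by (auto simp: is_equilibrium_def is_solution_def)
  have "(snd p)\<^sup>2 = \<alpha>2"
    using ne snd by (simp add: field_simps power2_eq_square)
  \<comment> \<open>Nonnegativity excludes the other root, \<open>- sqrt \<alpha>2\<close>.\<close>
  then have "snd p = sqrt \<alpha>2"
    using nonneg real_sqrt_unique by metis
  with fst show "p = (\<alpha>1 / (A1 + sqrt \<alpha>2), sqrt \<alpha>2)"
    by (simp add: prod_eq_iff)
next
  assume p: "p = (\<alpha>1 / (A1 + sqrt \<alpha>2), sqrt \<alpha>2)"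
  have "A1 + sqrt \<alpha>2 > 0"
    using assms by (simp add: add_pos_pos)
  then show "is_equilibrium \<alpha>1 A1 \<alpha>2 p"
    using assms by (simp add: p is_equilibrium_def is_solution_def real_div_sqrt)
qed

lemma solution_y_add_2:
  assumes "\<alpha>2 \<noteq> 0" "is_solution \<alpha>1 A1 \<alpha>2 x y"
  shows "y (n + 2) = y n"
  using assms by (simp add: is_solution_def)

text \<open>The index 0 is excluded because \<open>x 0\<close> is a free initial value, not computed
  from any y; from index 1 on, x is driven by the periodic y.\<close>

lemma solution_x_add_2:
  assumes "\<alpha>2 \<noteq> 0" "is_solution \<alpha>1 A1 \<alpha>2 x y" "n \<ge> 1"
  shows "x (n + 2) = x n"
proof -
  obtain m where n: "n = Suc m"
    using assms(3) by (cases n) auto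
  have "x (Suc k) = \<alpha>1 / (A1 + y k)" for k
    using assms(2) by (simp add: is_solution_def)
  from this[of m] this[of "m + 2"] show ?thesis
    using solution_y_add_2[OF assms(1,2), of m] by (simp add: n)
qed

theorem theorem2:
  fixes \<alpha>1 A1 \<alpha>2 :: real
  assumes "\<alpha>1 > 0" and "A1 > 0" and "\<alpha>2 > 0"
  shows "(\<exists>!p. is_equilibrium \<alpha>1 A1 \<alpha>2 p) \<and>
    is_equilibrium \<alpha>1 A1 \<alpha>2 (\<alpha>1 / (A1 + sqrt \<alpha>2), sqrt \<alpha>2) \<and>
    (\<forall>x y. is_solution \<alpha>1 A1 \<alpha>2 x y \<longrightarrow>
       (\<forall>n\<ge>1. (x n, y n) = (x (n + 2), y (n + 2)))) \<and>
    (\<forall>x y. is_solution \<alpha>1 A1 \<alpha>2 x y \<longrightarrow>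
       eventually_periodic 2 (\<lambda>n. (x n, y n)))"
proof -
  have periodic: "(x (n + 2), y (n + 2)) = (x n, y n)"
    if "is_solution \<alpha>1 A1 \<alpha>2 x y" "n \<ge> 1" for x y n
    using solution_x_add_2 solution_y_add_2 that assms(3) by (metis less_irrefl)
  \<comment> \<open>The threshold N = 1 serves for every solution.\<close>
  then have "eventually_periodic 2 (\<lambda>n. (x n, y n))"
    if "is_solution \<alpha>1 A1 \<alpha>2 x y" for x y
    using that unfolding eventually_periodic_def by (metis zero_less_numeral)
  with periodic show ?thesis
    by (metis is_equilibrium_iff[OF assms])
qed

end
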